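(* Let $\mathbf{k}$ be a field and let $(A,\cdot,\circ)$ be a Jacobi Novikov-Poisson algebra over $\mathbf{k}$. For any fixed element $\xi\in A$, define another binary operation $\times$ on $A$ by $$a\times b:=a\circ b+\xi\cdot a\cdot b\qquad\text{for all } a,b\in A.$$ Then $(A,\cdot,\times)$ is a Jacobi Novikov-Poisson algebra.
   Context: Binary operations are bilinear. A Novikov algebra $(A,\circ)$ is a vector space with a binary operation satisfying $(a\circ b)\circ c-a\circ(b\circ c)=(b\circ a)\circ c-b\circ(a\circ c)$ and $(a\circ b)\circ c=(a\circ c)\circ b$ for all $a,b,c\in A$. A Jacobi Novikov-Poisson algebra is a triple $(A,\cdot,\circ)$ where $(A,\cdot)$ is a unital commutative associative algebra with identity $1_A$, $(A,\circ)$ is a Novikov algebra, and for all $a,b,c\in A$: $(a\cdot b)\circ c=a\cdot(b\circ c)$ and $c\circ(a\cdot b)=(c\circ a)\cdot b+a\cdot(c\circ b)-a\cdot b\cdot(c\circ 1_A)$. *)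

theory Defs
  imports Complex_Main
begin

locale bilinear_operation = vector_space scale
  for scale :: "'k::field \<Rightarrow> 'a::ab_group_add \<Rightarrow> 'a" +
  fixes bop :: "'a \<Rightarrow> 'a \<Rightarrow> 'a"
  assumes linear_left: "Vector_Spaces.linear scale scale (\<lambda>a. bop a b)"
    and linear_right: "Vector_Spaces.linear scale scale (\<lambda>b. bop a b)"

locale novikov_algebra = bilinear_operation scale circ
  for scale :: "'k::field \<Rightarrow> 'a::ab_group_add \<Rightarrow> 'a"
    and circ :: "'a \<Rightarrow> 'a \<Rightarrow> 'a"  (infixl "\<circ>\<^sub>N" 70) +
  assumes left_symmetric:
      "(a \<circ>\<^sub>N b) \<circ>\<^sub>N c - a \<circ>\<^sub>N (b \<circ>\<^sub>N c) = (b \<circ>\<^sub>N a) \<circ>\<^sub>N c - b \<circ>\<^sub>N (a \<circ>\<^sub>N c)"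
    and right_commutative: "(a \<circ>\<^sub>N b) \<circ>\<^sub>N c = (a \<circ>\<^sub>N c) \<circ>\<^sub>N b"

(* The zero algebra (e = 0) is allowed. *)
locale unital_comm_assoc_algebra = bilinear_operation scale mul + comm_monoid mul e
  for scale :: "'k::field \<Rightarrow> 'a::ab_group_add \<Rightarrow> 'a"
    and mul :: "'a \<Rightarrow> 'a \<Rightarrow> 'a"
    and e :: 'a

(* The identity e is determined by mul; it is a parameter only so that it can be named. *)
locale jacobi_novikov_poisson_algebra =
  unital_comm_assoc_algebra scale mul e + novikov_algebra scale circ
  for scale :: "'k::field \<Rightarrow> 'a::ab_group_add \<Rightarrow> 'a"
    and mul :: "'a \<Rightarrow> 'a \<Rightarrow> 'a"  (infixl "\<cdot>" 70)
    and e :: 'a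
    and circ :: "'a \<Rightarrow> 'a \<Rightarrow> 'a"  (infixl "\<circ>\<^sub>N" 70) +
  assumes mul_circ: "(a \<cdot> b) \<circ>\<^sub>N c = a \<cdot> (b \<circ>\<^sub>N c)"
    and circ_mul:
      "c \<circ>\<^sub>N (a \<cdot> b) = (c \<circ>\<^sub>N a) \<cdot> b + a \<cdot> (c \<circ>\<^sub>N b) - (a \<cdot> b) \<cdot> (c \<circ>\<^sub>N e)"

end

theory Submission
  imports Defs
begin

text \<open>
  A Jacobi Novikov-Poisson algebra is determined by its commutative algebra and one linear
  operator: since $a \cdot (b \circ c) = (a \cdot b) \circ c$, taking $b$ to be the identity gives
  $a \circ c = a \cdot D(c)$ with $D(c) = 1_A \circ c$, and the compatibility condition becomes the
  twisted Leibniz rule $D(ab) = D(a)b + aD(b) - abD(1_A)$. Conversely, every linear operator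
  satisfying this rule produces a Jacobi Novikov-Poisson algebra (lemma
  \<open>twisted_derivation_gives_jacobi_novikov_poisson\<close>): the Novikov identities are automatic.

  In these terms, passing from $\circ$ to $\times$ replaces $D$ by $D + \xi\,\cdot$. The rule survives because
  multiplication by $\xi$ satisfies it too, as $\xi ab = \xi ab + \xi ab - \xi ab$, and
  the rule is linear in $D$.
\<close>

context unital_comm_assoc_algebra
begin

lemmas mul_add_left = module_hom.add[OF Vector_Spaces.linear.axioms(3)[OF linear_left]]
lemmas mul_add_right = module_hom.add[OF Vector_Spaces.linear.axioms(3)[OF linear_right]]
lemmas mul_diff_right = module_hom.diff[OF Vector_Spaces.linear.axioms(3)[OF linear_right]]

text \<open>
  Right commutativity only says that $a\,D(b)\,D(c)$ is symmetric in $b$ and $c$. For left symmetry,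
  the twisted Leibniz rule turns the associator $a D(b) D(c) - a D(b D(c))$ into
  $ab\,(D(c)\,D(1_A) - D(D(c)))$, which is symmetric in $a$ and $b$.
\<close>
lemma twisted_derivation_gives_jacobi_novikov_poisson:
  assumes lin: "Vector_Spaces.linear scale scale D"
    and leibniz: "\<And>a b. D (mul a b) = mul (D a) b + mul a (D b) - mul (mul a b) (D e)"
  shows "jacobi_novikov_poisson_algebra scale mul e (\<lambda>a b. mul a (D b))"
proof (intro jacobi_novikov_poisson_algebra.intro jacobi_novikov_poisson_algebra_axioms.intro
    novikov_algebra.intro novikov_algebra_axioms.intro
    bilinear_operation.intro bilinear_operation_axioms.intro
    unital_comm_assoc_algebra_axioms vector_space_axioms)
  fix a b c
  show "Vector_Spaces.linear scale scale (\<lambda>a. mul a (D b))"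
    by (rule linear_left)
  show "Vector_Spaces.linear scale scale (\<lambda>b. mul a (D b))"
    using Vector_Spaces.linear_compose[OF lin linear_right[of a]] by (simp add: comp_def)
  show "mul (mul a (D b)) (D c) = mul (mul a (D c)) (D b)"
    by (simp add: ac_simps)
  have associator: "mul (mul x (D y)) (D c) - mul x (D (mul y (D c)))
      = mul (mul x y) (mul (D c) (D e) - D (D c))" for x y
    by (simp add: leibniz mul_add_right mul_diff_right ac_simps)
  show "mul (mul a (D b)) (D c) - mul a (D (mul b (D c)))
      = mul (mul b (D a)) (D c) - mul b (D (mul a (D c)))"
    by (simp add: associator commute[of a b])
  show "mul (mul a b) (D c) = mul a (mul b (D c))"
    by (rule assoc)
  show "mul c (D (mul a b))
      = mul (mul c (D a)) b + mul a (mul c (D b)) - mul (mul a b) (mul c (D e))"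
    by (simp add: leibniz mul_add_right mul_diff_right ac_simps)
qed

end

theorem proposition2p15:
  fixes scale :: "'k::field \<Rightarrow> 'a::ab_group_add \<Rightarrow> 'a"
    and mul :: "'a \<Rightarrow> 'a \<Rightarrow> 'a"  (infixl "\<cdot>" 70)
    and e :: 'a
    and circ :: "'a \<Rightarrow> 'a \<Rightarrow> 'a"  (infixl "\<circ>\<^sub>N" 70)
    and \<xi> :: 'a
  assumes "jacobi_novikov_poisson_algebra scale (\<cdot>) e (\<circ>\<^sub>N)"
  shows "jacobi_novikov_poisson_algebra scale (\<cdot>) e (\<lambda>a b. a \<circ>\<^sub>N b + \<xi> \<cdot> a \<cdot> b)"
proof -
  interpret J: jacobi_novikov_poisson_algebra scale "(\<cdot>)" e "(\<circ>\<^sub>N)"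
    by (fact assms)
  interpret P: vector_space_pair scale scale
    by unfold_locales
  define D where "D = (\<lambda>b. e \<circ>\<^sub>N b + \<xi> \<cdot> b)"
  have "a \<circ>\<^sub>N b + \<xi> \<cdot> a \<cdot> b = a \<cdot> D b" for a b
    using J.mul_circ[of a e b] by (simp add: D_def J.mul_add_right J.assoc J.commute J.left_commute)
  moreover have "jacobi_novikov_poisson_algebra scale (\<cdot>) e (\<lambda>a b. a \<cdot> D b)"
  proof (rule J.twisted_derivation_gives_jacobi_novikov_poisson)
    show "Vector_Spaces.linear scale scale D"
      unfolding D_def
      by (intro P.linear_compose_add bilinear_operation.linear_right
          novikov_algebra.axioms(1)[OF J.novikov_algebra_axioms]
          unital_comm_assoc_algebra.axioms(1)[OF J.unital_comm_assoc_algebra_axioms])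
    show "D (a \<cdot> b) = D a \<cdot> b + a \<cdot> D b - (a \<cdot> b) \<cdot> D e" for a b
      by (simp add: D_def J.circ_mul J.mul_add_right J.mul_add_left J.assoc J.commute J.left_commute algebra_simps)
  qed
  ultimately show ?thesis
    by simp
qed

end
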